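(* Let $n\ge 2$ and let $K$ be a convex body in $\mathbb{R}^n$. Then for all $u,v\in S^{n-1}$ with $u\ne\pm v$: (1) $\displaystyle \frac{|w_K(u)-w_K(v)|}{\rho(u,v)}\le M_K:=\sqrt{\delta_K^2-\omega_K^2}$; (2) $\displaystyle \frac{|d_K(u)-d_K(v)|}{\rho(u,v)}\le N_K:=\frac{\delta_K}{\omega_K}\sqrt{\delta_K^2-\omega_K^2}$.
   Context: A convex body in $\mathbb{R}^n$ is a compact convex set with nonempty interior. A supporting hyperplane of $K$ is an affine hyperplane that intersects $K$ but not its interior. $S^{n-1}$ is the Euclidean unit sphere of $\mathbb{R}^n$. For $u\in S^{n-1}$, the width $w_K(u)$ is the distance between the two supporting hyperplanes of $K$ orthogonal to $u$, and the diameter $d_K(u)$ of $K$ in direction $u$ is the maximal length of a chord of $K$ parallel to $u$. $\delta_K:=\operatorname{diam}K=\max w_K=\max d_K$ is the diameter of $K$, and $\omega_K:=\min_{u\in S^{n-1}} w_K(u)$ is the thickness of $K$ (one has $\omega_K=\min d_K$). $\rho(u,v):=\arccos|\langle u,v\rangle|$ for $u,v\in S^{n-1}$. *)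

theory Defs
  imports "HOL-Analysis.Analysis"
begin

definition convex_body :: "'a::euclidean_space set \<Rightarrow> bool" where
  "convex_body K \<longleftrightarrow> compact K \<and> convex K \<and> interior K \<noteq> {}"

definition supporting_hyperplane :: "'a::euclidean_space set \<Rightarrow> 'a set \<Rightarrow> bool" where
  "supporting_hyperplane K H \<longleftrightarrow>
     (\<exists>a b. a \<noteq> 0 \<and> H = {x. a \<bullet> x = b}) \<and> H \<inter> K \<noteq> {} \<and> H \<inter> interior K = {}"

definition supporting_hyperplanes_orthogonal ::
  "'a::euclidean_space set \<Rightarrow> 'a \<Rightarrow> 'a set set" where
  "supporting_hyperplanes_orthogonal K u =
     {H. supporting_hyperplane K H \<and> (\<exists>b. H = {x. u \<bullet> x = b})}"

text \<open>The description is meaningful when \<open>K\<close> is a convex body and \<open>u\<close> a unit vector: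
  there are then exactly two supporting hyperplanes orthogonal to \<open>u\<close>
  (see \<open>supporting_hyperplanes_orthogonal_eq\<close> and \<open>width_eq\<close> below).\<close>

definition width :: "'a::euclidean_space set \<Rightarrow> 'a \<Rightarrow> real" where
  "width K u = (THE w. \<exists>H1 H2. H1 \<noteq> H2 \<and>
     supporting_hyperplanes_orthogonal K u = {H1, H2} \<and> w = setdist H1 H2)"

text \<open>A chord of \<open>K\<close> is a nondegenerate segment whose endpoints lie on the boundary of \<open>K\<close>.
  The supremum is attained for a convex body.\<close>

definition directional_diameter :: "'a::euclidean_space set \<Rightarrow> 'a \<Rightarrow> real" where
  "directional_diameter K u =
     Sup {dist x y | x y. x \<in> frontier K \<and> y \<in> frontier K \<and> x \<noteq> y \<and> (\<exists>t. y - x = t *\<^sub>R u)}"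

text \<open>For a convex body the infimum is a minimum.\<close>

definition thickness :: "'a::euclidean_space set \<Rightarrow> real" where
  "thickness K = (INF u\<in>sphere 0 1. width K u)"

definition line_angle :: "'a::euclidean_space \<Rightarrow> 'a \<Rightarrow> real" where
  "line_angle u v = arccos \<bar>u \<bullet> v\<bar>"

lemma supporting_hyperplanes_orthogonal_eq:
  fixes K :: "'a::euclidean_space set"
  assumes K: "convex_body K" and u: "norm u = 1"
  defines "m \<equiv> Inf ((\<bullet>) u ` K)" and "M \<equiv> Sup ((\<bullet>) u ` K)"
  shows "m < M"
    and "supporting_hyperplanes_orthogonal K u = {{x. u \<bullet> x = m}, {x. u \<bullet> x = M}}"
proof -
  have K': "compact K" "convex K" "interior K \<noteq> {}"
    using K by (auto simp: convex_body_def)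
  have ne: "K \<noteq> {}" using K'(3) interior_subset by blast
  have uu: "u \<bullet> u = 1" using u norm_eq_1 by blast
  have u0: "u \<noteq> 0" using uu by force
  have cpt: "compact ((\<bullet>) u ` K)"
    by (intro compact_continuous_image K' continuous_intros)
  have bdd: "bdd_below ((\<bullet>) u ` K)" "bdd_above ((\<bullet>) u ` K)"
    by (rule bounded_imp_bdd_below[OF compact_imp_bounded[OF cpt]],
        rule bounded_imp_bdd_above[OF compact_imp_bounded[OF cpt]])
  have ne': "(\<bullet>) u ` K \<noteq> {}" using ne by blast
  have mM: "m \<in> (\<bullet>) u ` K" "M \<in> (\<bullet>) u ` K"
    unfolding m_def M_def
    by (rule closed_contains_Inf[OF ne' bdd(1) compact_imp_closed[OF cpt]],
        rule closed_contains_Sup[OF ne' bdd(2) compact_imp_closed[OF cpt]])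
  have bd: "m \<le> u \<bullet> x" "u \<bullet> x \<le> M" if "x \<in> K" for x
    unfolding m_def M_def
    by (rule cInf_lower[OF imageI[OF that] bdd(1)], rule cSup_upper[OF imageI[OF that] bdd(2)])
  have int: "m < u \<bullet> x \<and> u \<bullet> x < M" if x: "x \<in> interior K" for x
  proof -
    obtain e where e: "e > 0" "cball x e \<subseteq> K"
      using x by (meson mem_interior_cball)
    have "x + e *\<^sub>R u \<in> K" "x - e *\<^sub>R u \<in> K"
      using e u by (auto intro!: subsetD[OF e(2)] simp: dist_norm)
    from bd(2)[OF this(1)] bd(1)[OF this(2)] e(1) show ?thesis
      by (simp add: inner_add_right inner_diff_right uu)
  qed
  obtain z where z: "z \<in> interior K" using K'(3) by blast
  show mlt: "m < M" using int[OF z] by linarith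
  have cl: "K \<subseteq> closure (interior K)"
    using K' convex_closure_interior closure_subset by metis
  have hit: "\<exists>x\<in>interior K. u \<bullet> x = c" if c: "m < c" "c < M" for c
  proof -
    obtain p q where pq: "p \<in> K" "u \<bullet> p = m" "q \<in> K" "u \<bullet> q = M"
      using mM by auto
    have "interior K \<inter> {x. u \<bullet> x < c} \<noteq> {}"
      using cl pq c open_Int_closure_eq_empty[OF open_halfspace_lt[of u c], of "interior K"]
      by (auto simp: Int_commute)
    then obtain p' where p': "p' \<in> interior K" "u \<bullet> p' \<le> c" by force
    have "interior K \<inter> {x. u \<bullet> x > c} \<noteq> {}"
      using cl pq c open_Int_closure_eq_empty[OF open_halfspace_gt[of c u], of "interior K"]
      by (auto simp: Int_commute)
    then obtain q' where q': "q' \<in> interior K" "c \<le> u \<bullet> q'" by force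
    show ?thesis
      using connected_ivt_hyperplane[OF convex_connected[OF convex_interior[OF K'(2)]]
          p'(1) q'(1) p'(2) q'(2)] by auto
  qed
  have "supporting_hyperplane K {x. u \<bullet> x = b} \<longleftrightarrow> b = m \<or> b = M" for b
  proof
    assume A: "supporting_hyperplane K {x. u \<bullet> x = b}"
    then obtain x where "x \<in> K" "u \<bullet> x = b"
      by (auto simp: supporting_hyperplane_def)
    with bd have "m \<le> b" "b \<le> M" by auto
    moreover have "\<not> (m < b \<and> b < M)"
      using hit[of b] A by (auto simp: supporting_hyperplane_def)
    ultimately show "b = m \<or> b = M" by linarith
  next
    assume "b = m \<or> b = M"
    then have "{x. u \<bullet> x = b} \<inter> K \<noteq> {}" "{x. u \<bullet> x = b} \<inter> interior K = {}"
      using mM int by (fastforce, fastforce)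
    then show "supporting_hyperplane K {x. u \<bullet> x = b}"
      using u0 unfolding supporting_hyperplane_def by blast
  qed
  then show "supporting_hyperplanes_orthogonal K u = {{x. u \<bullet> x = m}, {x. u \<bullet> x = M}}"
    by (auto simp: supporting_hyperplanes_orthogonal_def)
qed

lemma width_eq:
  fixes K :: "'a::euclidean_space set"
  assumes K: "convex_body K" and u: "norm u = 1"
  shows "width K u = Sup ((\<bullet>) u ` K) - Inf ((\<bullet>) u ` K)"
proof -
  define m M where "m = Inf ((\<bullet>) u ` K)" and "M = Sup ((\<bullet>) u ` K)"
  let ?A = "{x. u \<bullet> x = m}" and ?B = "{x. u \<bullet> x = M}"
  note eq = supporting_hyperplanes_orthogonal_eq[OF K u, folded m_def M_def]
  have uu: "u \<bullet> u = 1" using u norm_eq_1 by blast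
  have inA: "m *\<^sub>R u \<in> ?A" and inB: "M *\<^sub>R u \<in> ?B" using uu by auto
  have "m *\<^sub>R u \<notin> ?B" using eq(1) uu by simp
  with inA have neq: "?A \<noteq> ?B" by blast
  have "setdist ?A ?B \<le> dist (m *\<^sub>R u) (M *\<^sub>R u)"
    using inA inB by (rule setdist_le_dist)
  also have "\<dots> = M - m"
    using eq(1) u by (simp add: dist_norm flip: scaleR_diff_left)
  finally have le: "setdist ?A ?B \<le> M - m" .
  have ge: "M - m \<le> setdist ?A ?B"
  proof (rule le_setdistI)
    fix x y assume "x \<in> ?A" "y \<in> ?B"
    then have "M - m = u \<bullet> (y - x)" by (simp add: inner_diff_right)
    also have "\<dots> \<le> norm u * norm (y - x)" by (rule norm_cauchy_schwarz)
    finally show "M - m \<le> dist x y" using u by (simp add: dist_norm norm_minus_commute)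
  qed (use inA inB in blast)+
  have d: "setdist ?A ?B = M - m" using le ge by linarith
  have "width K u = M - m"
    unfolding width_def
  proof (rule the_equality)
    show "\<exists>H1 H2. H1 \<noteq> H2 \<and> supporting_hyperplanes_orthogonal K u = {H1, H2} \<and>
        M - m = setdist H1 H2"
      using neq eq(2) d by metis
  next
    fix w assume "\<exists>H1 H2. H1 \<noteq> H2 \<and> supporting_hyperplanes_orthogonal K u = {H1, H2} \<and>
        w = setdist H1 H2"
    then obtain H1 H2 where "{?A, ?B} = {H1, H2}" "w = setdist H1 H2"
      unfolding eq(2) by blast
    then show "w = M - m" using d setdist_sym[of ?A ?B] by (auto simp: doubleton_eq_iff)
  qed
  then show ?thesis by (simp add: m_def M_def)
qed

end

theory Submission
  imports Defs
begin

text \<open>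
  Width and directional diameter of \<open>K\<close> are the support function and the radial function of the
  difference body \<open>K - K\<close>.  Replacing \<open>v\<close> by \<open>- v\<close>, assume that the angle between \<open>u\<close> and \<open>v\<close> is not
  obtuse.  If \<open>x\<close> in the difference body attains the larger width \<open>p\<close> in direction \<open>u\<close> and \<open>q\<close> is the
  width in direction \<open>v\<close>, then \<open>p = norm x * cos \<phi>\<close> and \<open>q = norm x * cos \<psi>\<close> where, by the spherical
  triangle inequality, \<open>\<psi> - \<phi>\<close> is at most the angle between \<open>u\<close> and \<open>v\<close>; the first claim is then a
  secant estimate for the cosine.  The second claim follows dually, with the point \<open>x\<close> replaced by a
  normal vector of the difference body at its boundary point in the direction of smaller diameter.
\<close>

section \<open>Spherical triangle inequality and secant estimate for the cosine\<close>

text \<open>Cauchy-Schwarz for the components of \<open>a\<close> and \<open>c\<close> orthogonal to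
  \<open>b\<close> bounds \<open>a \<bullet> c\<close> below by the cosine of the sum of the two
  angles. The cosine decreases on [0, pi], and a sum beyond pi exceeds every value of
  \<open>arccos\<close>.\<close>

lemma arccos_inner_triangle:
  fixes a b c :: "'a::real_inner"
  assumes "norm a = 1" "norm b = 1" "norm c = 1"
  shows "arccos (a \<bullet> c) \<le> arccos (a \<bullet> b) + arccos (b \<bullet> c)"
proof (cases "arccos (a \<bullet> b) + arccos (b \<bullet> c) \<le> pi")
  case True
  define x y where "x = a \<bullet> b" and "y = b \<bullet> c"
  have bounds: "\<bar>x\<bar> \<le> 1" "\<bar>y\<bar> \<le> 1" "\<bar>a \<bullet> c\<bar> \<le> 1"
    using assms Cauchy_Schwarz_ineq2[of a b] Cauchy_Schwarz_ineq2[of b c]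
      Cauchy_Schwarz_ineq2[of a c] by (auto simp: x_def y_def)
  have unit: "a \<bullet> a = 1" "b \<bullet> b = 1" "c \<bullet> c = 1"
    using assms by (auto simp: norm_eq_1)
  have na: "norm (a - x *\<^sub>R b) = sqrt (1 - x\<^sup>2)" and nc: "norm (c - y *\<^sub>R b) = sqrt (1 - y\<^sup>2)"
    unfolding norm_eq_sqrt_inner x_def y_def
    by (simp_all add: inner_diff_left inner_diff_right unit inner_commute power2_eq_square)
  have "a \<bullet> c - x * y = (a - x *\<^sub>R b) \<bullet> (c - y *\<^sub>R b)"
    unfolding x_def y_def
    by (simp add: inner_diff_left inner_diff_right unit inner_commute)
  then have "x * y - sqrt (1 - x\<^sup>2) * sqrt (1 - y\<^sup>2) \<le> a \<bullet> c"
    using Cauchy_Schwarz_ineq2[of "a - x *\<^sub>R b" "c - y *\<^sub>R b"] by (simp add: na nc)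
  then have "cos (arccos x + arccos y) \<le> cos (arccos (a \<bullet> c))"
    using bounds by (simp add: cos_add sin_arccos_abs abs_le_iff)
  then show ?thesis
    using bounds True
      arccos_bounded[of "a \<bullet> c"] arccos_lbound[of x] arccos_lbound[of y]
    by (subst (asm) cos_mono_le_eq) (auto simp: x_def y_def abs_le_iff)
next
  case False
  have "\<bar>a \<bullet> c\<bar> \<le> 1" using assms Cauchy_Schwarz_ineq2[of a c] by simp
  then show ?thesis using False arccos_ubound[of "a \<bullet> c"] by (auto simp: abs_le_iff)
qed

text \<open>In the product formula the sine at the midpoint is at most \<open>sin b\<close> by
  monotonicity, and the sine of half the difference is at most its argument.\<close>

lemma cos_diff_le_sin:
  fixes a b :: real
  assumes "0 \<le> a" "a \<le> b" "b \<le> pi / 2"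
  shows "cos a - cos b \<le> (b - a) * sin b"
proof -
  have "cos a - cos b = 2 * sin ((a + b) / 2) * sin ((b - a) / 2)"
    by (simp add: cos_diff_cos)
  also have "\<dots> \<le> 2 * sin b * ((b - a) / 2)"
    using assms
    by (intro mult_mono mult_left_mono sin_monotone_2pi_le sin_x_le_x mult_nonneg_nonneg sin_ge_zero) auto
  finally show ?thesis by (simp add: mult.commute)
qed

text \<open>This is the cosine estimate for the angles with cosines \<open>p / r\<close> and
  \<open>q / r\<close>, scaled by \<open>r\<close>; the root is \<open>r\<close> times the sine of
  the larger angle.\<close>

lemma diff_le_arccos_diff:
  fixes p q r :: real
  assumes "0 < q" "q \<le> p" "p \<le> r"
  shows "p - q \<le> (arccos (q / r) - arccos (p / r)) * sqrt (r\<^sup>2 - q\<^sup>2)"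
proof -
  have r: "0 < r" using assms by linarith
  have rng: "0 < q / r" "q / r \<le> p / r" "p / r \<le> 1"
    using assms r by (auto simp: divide_right_mono)
  have "cos (arccos (p / r)) - cos (arccos (q / r))
      \<le> (arccos (q / r) - arccos (p / r)) * sin (arccos (q / r))"
    using rng by (intro cos_diff_le_sin arccos_lbound arccos_le_arccos arccos_le_pi2) auto
  then have "(p - q) / r \<le> (arccos (q / r) - arccos (p / r)) * sqrt (1 - (q / r)\<^sup>2)"
    using rng by (simp add: sin_arccos diff_divide_distrib)
  then have "p - q \<le> (arccos (q / r) - arccos (p / r)) * (r * sqrt (1 - (q / r)\<^sup>2))"
    using r by (simp add: pos_divide_le_eq mult_ac)
  also have "r * sqrt (1 - (q / r)\<^sup>2) = sqrt (r\<^sup>2 * (1 - (q / r)\<^sup>2))"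
    using r by (simp add: real_sqrt_mult)
  also have "r\<^sup>2 * (1 - (q / r)\<^sup>2) = r\<^sup>2 - q\<^sup>2"
    using r by (simp add: right_diff_distrib power_divide)
  finally show ?thesis .
qed

section \<open>The difference body\<close>

text \<open>The nested union is the form in which \<open>convex_differences\<close> gives
  convexity.\<close>

definition difference_body :: "'a::real_vector set \<Rightarrow> 'a set" where
  "difference_body K = (\<Union>x\<in>K. \<Union>y\<in>K. {x - y})"

lemma mem_difference_body: "z \<in> difference_body K \<longleftrightarrow> (\<exists>x\<in>K. \<exists>y\<in>K. z = x - y)"
  by (auto simp: difference_body_def)

lemma uminus_mem_difference_body: "- z \<in> difference_body K \<longleftrightarrow> z \<in> difference_body K"
  unfolding mem_difference_body by (metis minus_diff_eq minus_minus)

locale convex_body_locale =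
  fixes K :: "'a::euclidean_space set"
  assumes body: "convex_body K"
begin

lemma compact_K: "compact K" and convex_K: "convex K" and interior_K: "interior K \<noteq> {}"
  using body by (auto simp: convex_body_def)

lemma compact_D: "compact (difference_body K)"
proof -
  have "difference_body K = {x - y |x y. x \<in> K \<and> y \<in> K}"
    by (auto simp: difference_body_def)
  then show ?thesis using compact_differences[OF compact_K compact_K] by simp
qed

lemma convex_D: "convex (difference_body K)"
  unfolding difference_body_def by (rule convex_differences[OF convex_K convex_K])

lemma norm_D_le: "z \<in> difference_body K \<Longrightarrow> norm z \<le> diameter K"
  using diameter_bounded_bound[OF compact_imp_bounded[OF compact_K]]
  by (force simp: mem_difference_body dist_norm)

lemma ball_D: obtains e where "e > 0" "cball 0 e \<subseteq> difference_body K"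
proof -
  obtain z e where e: "e > 0" "cball z e \<subseteq> K"
    using interior_K by (meson ex_in_conv mem_interior_cball)
  have "x \<in> difference_body K" if "norm x \<le> e" for x
    unfolding mem_difference_body
    using that e by (intro bexI[of _ "z + x"] bexI[of _ z]) (auto simp: dist_norm)
  then show ?thesis using e that by (auto simp: subset_eq)
qed

section \<open>Width as support function, and thickness\<close>

text \<open>The maximum minus the minimum of \<open>u\<close> over \<open>K\<close> is the maximum
  of \<open>u\<close> over differences of points of \<open>K\<close>.\<close>

lemma width_attained:
  assumes u: "norm u = 1"
  shows "\<exists>x\<in>difference_body K. u \<bullet> x = width K u"
    and "z \<in> difference_body K \<Longrightarrow> u \<bullet> z \<le> width K u"
proof -
  have ne: "(\<bullet>) u ` K \<noteq> {}" using interior_K interior_subset by blast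
  have cpt: "compact ((\<bullet>) u ` K)"
    by (intro compact_continuous_image compact_K continuous_intros)
  note bdd = bounded_imp_bdd_below[OF compact_imp_bounded[OF cpt]]
    bounded_imp_bdd_above[OF compact_imp_bounded[OF cpt]]
  have "Inf ((\<bullet>) u ` K) \<in> (\<bullet>) u ` K" "Sup ((\<bullet>) u ` K) \<in> (\<bullet>) u ` K"
    using closed_contains_Inf[OF ne bdd(1) compact_imp_closed[OF cpt]]
      closed_contains_Sup[OF ne bdd(2) compact_imp_closed[OF cpt]] by auto
  then obtain x y where xy: "x \<in> K" "y \<in> K"
      "u \<bullet> x = Sup ((\<bullet>) u ` K)" "u \<bullet> y = Inf ((\<bullet>) u ` K)"
    unfolding image_iff by fastforce
  show "\<exists>x\<in>difference_body K. u \<bullet> x = width K u"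
  proof
    show "u \<bullet> (x - y) = width K u"
      by (simp only: width_eq[OF body u] inner_diff_right xy)
    show "x - y \<in> difference_body K" using xy(1,2) mem_difference_body by blast
  qed
  show "u \<bullet> z \<le> width K u" if zD: "z \<in> difference_body K"
  proof -
    obtain x y where "x \<in> K" "y \<in> K" "z = x - y"
      using zD unfolding mem_difference_body by blast
    then show ?thesis
      using cInf_lower[OF imageI[OF \<open>y \<in> K\<close>] bdd(1)] cSup_upper[OF imageI[OF \<open>x \<in> K\<close>] bdd(2)]
      by (simp add: width_eq[OF body u] inner_diff_right)
  qed
qed

lemma width_minus:
  assumes "norm u = 1"
  shows "width K (- u) = width K u"
proof (rule antisym)
  have le: "width K (- v) \<le> width K v" if v: "norm v = 1" for v
  proof -
    obtain x where "x \<in> difference_body K" "(- v) \<bullet> x = width K (- v)"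
      using width_attained(1)[of "- v"] v by auto
    then show ?thesis
      using width_attained(2)[OF v, of "- x"] by (simp add: uminus_mem_difference_body)
  qed
  show "width K (- u) \<le> width K u" using le[OF assms] .
  show "width K u \<le> width K (- u)" using le[of "- u"] assms by simp
qed

text \<open>A ball of radius \<open>e\<close> about the origin inside the difference body makes
  every width at least \<open>e\<close>, so the infimum is positive and bounds each width from
  below.\<close>

lemma thickness_pos: "0 < thickness K"
  and thickness_le_width: "norm u = 1 \<Longrightarrow> thickness K \<le> width K u"
proof -
  obtain e where e: "e > 0" "cball 0 e \<subseteq> difference_body K" by (rule ball_D)
  have ge: "e \<le> width K u" if u: "norm u = 1" for u
  proof -
    have "e *\<^sub>R u \<in> difference_body K" using e u by (auto intro!: subsetD[OF e(2)])
    then show ?thesis using width_attained(2)[OF u] u by (force simp: norm_eq_1)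
  qed
  then have bdd: "bdd_below (width K ` sphere 0 1)" by (auto intro!: bdd_belowI[of _ e])
  obtain b :: 'a where "norm b = 1" using vector_choose_size[of 1] by auto
  then have "sphere (0::'a) 1 \<noteq> {}" by auto
  then have "e \<le> thickness K" unfolding thickness_def using ge by (intro cINF_greatest) auto
  then show "0 < thickness K" using e by linarith
  show "thickness K \<le> width K u" if "norm u = 1"
    unfolding thickness_def using that by (intro cINF_lower bdd) auto
qed

section \<open>Directional diameter as radial function\<close>

text \<open>The largest \<open>t\<close> with \<open>t *\<^sub>R u\<close> in the difference body is
  the length of a longest segment in \<open>K\<close> parallel to \<open>u\<close>. Its endpoints
  lie on the frontier, so it is a chord.\<close>

lemma directional_diameter_attained:
  assumes u: "norm u = 1"
  shows "directional_diameter K u *\<^sub>R u \<in> difference_body K"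
    and "t *\<^sub>R u \<in> difference_body K \<Longrightarrow> t \<le> directional_diameter K u"
    and "0 < directional_diameter K u"
proof -
  define S where "S = {t. t *\<^sub>R u \<in> difference_body K}"
  obtain e where e: "e > 0" "cball 0 e \<subseteq> difference_body K" by (rule ball_D)
  have eS: "e \<in> S" using e u by (auto simp: S_def intro!: subsetD[OF e(2)])
  have "closed S"
  proof -
    have "S = (\<lambda>t. t *\<^sub>R u) -` difference_body K" by (auto simp: S_def)
    then show ?thesis
      using continuous_closed_vimage[OF compact_imp_closed[OF compact_D], of "\<lambda>t. t *\<^sub>R u"]
      by simp
  qed
  moreover have bdd: "bdd_above S"
    using norm_D_le u by (fastforce simp: S_def intro!: bdd_aboveI[of _ "diameter K"])
  ultimately have TS: "Sup S \<in> S" using closed_contains_Sup eS by blast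
  have T_ub: "t \<le> Sup S" if "t \<in> S" for t using that bdd by (rule cSup_upper)
  have T_pos: "0 < Sup S" using T_ub[OF eS] e by linarith
  obtain y x where xy: "x \<in> K" "y \<in> K" "y - x = Sup S *\<^sub>R u"
    using TS by (auto simp: S_def mem_difference_body)
  \<comment> \<open>An interior endpoint could be pushed outward by \<open>d\<close>, which would
    contradict the maximality of \<open>Sup S\<close>.\<close>
  have no_ext: False if "y' \<in> K" "x' \<in> K" "y' - x' = (Sup S + d) *\<^sub>R u" "d > 0" for y' x' d
    using that T_ub[of "Sup S + d"] by (force simp: S_def mem_difference_body)
  have "x \<notin> interior K"
  proof
    assume "x \<in> interior K"
    then obtain d where d: "d > 0" "cball x d \<subseteq> K" by (meson mem_interior_cball)
    have "x - d *\<^sub>R u \<in> K" using d u by (intro subsetD[OF d(2)]) (simp add: dist_norm)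
    moreover have "y - (x - d *\<^sub>R u) = (Sup S + d) *\<^sub>R u"
      using xy(3) by (simp add: scaleR_add_left)
    ultimately show False using no_ext xy(2) d(1) by blast
  qed
  moreover have "y \<notin> interior K"
  proof
    assume "y \<in> interior K"
    then obtain d where d: "d > 0" "cball y d \<subseteq> K" by (meson mem_interior_cball)
    have "y + d *\<^sub>R u \<in> K" using d u by (intro subsetD[OF d(2)]) (simp add: dist_norm)
    moreover have "y + d *\<^sub>R u - x = (Sup S + d) *\<^sub>R u"
      using xy(3) by (simp add: scaleR_add_left)
    ultimately show False using no_ext xy(1) d(1) by blast
  qed
  ultimately have fr: "x \<in> frontier K" "y \<in> frontier K"
    using xy closure_subset by (auto simp: frontier_def)
  have dd: "directional_diameter K u = Sup S"
    unfolding directional_diameter_def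
  proof (rule cSup_eq_maximum)
    have "dist x y = Sup S"
      using xy(3) u T_pos by (simp add: dist_norm norm_minus_commute[of x y])
    moreover have "x \<noteq> y" using calculation T_pos by auto
    ultimately show "Sup S \<in> {dist x y |x y. x \<in> frontier K \<and> y \<in> frontier K \<and> x \<noteq> y \<and>
        (\<exists>t. y - x = t *\<^sub>R u)}"
      using fr xy(3) by (intro CollectI exI[of _ x] exI[of _ y]) auto
  next
    fix r assume "r \<in> {dist x y |x y. x \<in> frontier K \<and> y \<in> frontier K \<and> x \<noteq> y \<and>
        (\<exists>t. y - x = t *\<^sub>R u)}"
    then obtain a b t where ab: "a \<in> frontier K" "b \<in> frontier K" "b - a = t *\<^sub>R u" "r = dist a b"
      by blast
    have "a \<in> K" "b \<in> K"
      using ab frontier_subset_compact[OF compact_K] by auto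
    then have "t *\<^sub>R u \<in> difference_body K" using ab(3) by (metis mem_difference_body)
    \<comment> \<open>The factor \<open>t\<close> may be negative; the symmetry of the difference
      body then gives the bound for its absolute value.\<close>
    then have "t \<in> S" "- t \<in> S"
      using uminus_mem_difference_body[of "t *\<^sub>R u" K] by (auto simp: S_def)
    moreover have "r = \<bar>t\<bar>"
      using ab(3,4) u by (simp add: dist_norm norm_minus_commute[of a b])
    ultimately show "r \<le> Sup S" using T_ub by (auto simp: abs_le_iff abs_if)
  qed
  show "directional_diameter K u *\<^sub>R u \<in> difference_body K"
    "t *\<^sub>R u \<in> difference_body K \<Longrightarrow> t \<le> directional_diameter K u"
    "0 < directional_diameter K u"
    unfolding dd using TS T_ub T_pos by (auto simp: S_def)
qed

lemma directional_diameter_minus: "directional_diameter K (- u) = directional_diameter K u"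
proof -
  have "(\<exists>t. z = t *\<^sub>R (- u)) \<longleftrightarrow> (\<exists>t. z = t *\<^sub>R u)" for z
    by (metis minus_minus scaleR_minus_left scaleR_minus_right)
  then show ?thesis unfolding directional_diameter_def by simp
qed

text \<open>The unit vector \<open>w\<close> is an outer normal of the difference body at its boundary point in
  direction \<open>v\<close>.\<close>

lemma directional_diameter_normal:
  assumes v: "norm v = 1"
  obtains w where "norm w = 1" "width K w = directional_diameter K v * (w \<bullet> v)"
proof -
  let ?q = "directional_diameter K v" and ?D = "difference_body K"
  note dd = directional_diameter_attained[OF v]
  obtain e where e: "e > 0" "cball 0 e \<subseteq> ?D" by (rule ball_D)
  have "?q *\<^sub>R v \<notin> interior ?D"
  proof
    assume "?q *\<^sub>R v \<in> interior ?D"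
    then obtain d where d: "d > 0" "cball (?q *\<^sub>R v) d \<subseteq> ?D" by (meson mem_interior_cball)
    have "(?q + d) *\<^sub>R v \<in> ?D"
      using d v by (intro subsetD[OF d(2)]) (simp add: dist_norm scaleR_add_left)
    then show False using dd(2) d(1) by force
  qed
  moreover have "interior ?D \<noteq> {}"
    using e interior_mono[OF e(2)] by (force simp: interior_cball)
  \<comment> \<open>The supporting hyperplane theorem speaks of the relative interior, which is the
    interior here because the latter is nonempty.\<close>
  ultimately have "?q *\<^sub>R v \<notin> rel_interior ?D"
    by (simp add: rel_interior_nonempty_interior)
  then obtain a where a: "a \<noteq> 0" "\<And>z. z \<in> closure ?D \<Longrightarrow> a \<bullet> (?q *\<^sub>R v) \<le> a \<bullet> z"
    using supporting_hyperplane_relative_frontier[OF convex_D] dd(1) closure_subset by (metis subsetD)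
  \<comment> \<open>The theorem minimizes \<open>a\<close> at the boundary point; the sign change
    turns it into an outer normal.\<close>
  define w where "w = - a"
  have w: "w \<noteq> 0" "w \<bullet> z \<le> w \<bullet> (?q *\<^sub>R v)" if "z \<in> ?D" for z
    using a(1) a(2)[of z] closure_subset[of ?D] that by (auto simp: w_def)
  define w' where "w' = w /\<^sub>R norm w"
  have n: "norm w' = 1" using w(1)[OF dd(1)] by (simp add: w'_def)
  have le: "w' \<bullet> z \<le> w' \<bullet> (?q *\<^sub>R v)" if "z \<in> ?D" for z
    using mult_left_mono[OF w(2)[OF that], of "inverse (norm w)"]
    by (simp add: w'_def mult.left_commute)
  obtain z where "z \<in> ?D" "w' \<bullet> z = width K w'" using width_attained(1)[OF n] by blast
  then have "width K w' = w' \<bullet> (?q *\<^sub>R v)"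
    using le width_attained(2)[OF n dd(1)] by force
  then show ?thesis using that n by simp
qed

section \<open>Lipschitz estimates\<close>

text \<open>No sign of \<open>u \<bullet> v\<close> is assumed: the full angle
  \<open>arccos (u \<bullet> v)\<close> suffices here, and the choice between \<open>v\<close> and
  \<open>- v\<close> comes later.\<close>

lemma width_diff_le:
  assumes u: "norm u = 1" and v: "norm v = 1" and le: "width K v \<le> width K u"
  shows "width K u - width K v \<le> arccos (u \<bullet> v) * sqrt ((diameter K)\<^sup>2 - (thickness K)\<^sup>2)"
proof -
  let ?p = "width K u" and ?q = "width K v"
  obtain x where x: "x \<in> difference_body K" "u \<bullet> x = ?p"
    using width_attained(1)[OF u] by blast
  define r where "r = norm x"
  have q: "thickness K \<le> ?q" "0 < ?q"
    using thickness_le_width[OF v] thickness_pos by auto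
  have pr: "?p \<le> r" using norm_cauchy_schwarz[of u x] x u by (simp add: r_def)
  have r: "0 < r" "r \<le> diameter K" using pr le q norm_D_le[OF x(1)] by (auto simp: r_def)
  define y where "y = x /\<^sub>R r"
  have y: "norm y = 1" using r by (simp add: y_def r_def)
  have yu: "y \<bullet> u = ?p / r" using x by (simp add: y_def inner_commute divide_inverse)
  \<comment> \<open>Only an inequality holds at \<open>v\<close>, since \<open>x\<close> need not
    attain the width there; as \<open>arccos\<close> is decreasing, it points the right way.\<close>
  have yv: "y \<bullet> v \<le> ?q / r"
    using width_attained(2)[OF v x(1)] r
    by (simp add: y_def inner_commute field_simps)
  have "-1 \<le> y \<bullet> v" using Cauchy_Schwarz_ineq2[of y v] y v by (simp add: abs_le_iff)
  then have "arccos (?q / r) \<le> arccos (y \<bullet> v)"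
    using yv pr le r by (intro arccos_le_arccos) auto
  also have "\<dots> \<le> arccos (?p / r) + arccos (u \<bullet> v)"
    using arccos_inner_triangle[OF y u v] yu by simp
  finally have ang: "arccos (?q / r) - arccos (?p / r) \<le> arccos (u \<bullet> v)" by simp
  have "?p - ?q \<le> (arccos (?q / r) - arccos (?p / r)) * sqrt (r\<^sup>2 - ?q\<^sup>2)"
    using diff_le_arccos_diff q le pr by blast
  also have "\<dots> \<le> arccos (u \<bullet> v) * sqrt (r\<^sup>2 - ?q\<^sup>2)"
    using ang pr q le by (intro mult_right_mono) (auto intro!: power_mono)
  \<comment> \<open>The bounds \<open>r\<close> \<le> \<open>diameter K\<close> and
    \<open>thickness K\<close> \<le> \<open>?q\<close> can only enlarge the root.\<close>
  also have "\<dots> \<le> arccos (u \<bullet> v) * sqrt ((diameter K)\<^sup>2 - (thickness K)\<^sup>2)"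
    using r q thickness_pos Cauchy_Schwarz_ineq2[of u v] u v
    by (intro mult_left_mono real_sqrt_le_mono diff_mono power_mono arccos_lbound)
      (auto simp: abs_le_iff)
  finally show ?thesis .
qed

text \<open>For the normal \<open>w\<close> at the boundary point in direction \<open>v\<close>, of
  width \<open>h\<close>, the support inequality is an equality at \<open>v\<close> and gives
  \<open>w \<bullet> v = h / ?q\<close>; at \<open>u\<close> it gives
  \<open>w \<bullet> u \<le> h / ?p\<close>. The triangle inequality compares these angles.\<close>

lemma directional_diameter_diff_le:
  assumes u: "norm u = 1" and v: "norm v = 1"
    and le: "directional_diameter K v \<le> directional_diameter K u"
  shows "directional_diameter K u - directional_diameter K v \<le>
    arccos (u \<bullet> v) * (diameter K / thickness K * sqrt ((diameter K)\<^sup>2 - (thickness K)\<^sup>2))"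
proof -
  let ?p = "directional_diameter K u" and ?q = "directional_diameter K v"
  obtain w where w: "norm w = 1" "width K w = ?q * (w \<bullet> v)"
    by (rule directional_diameter_normal[OF v])
  define h where "h = width K w"
  have h: "thickness K \<le> h" "0 < h"
    using thickness_le_width[OF w(1)] thickness_pos by (auto simp: h_def)
  note du = directional_diameter_attained[OF u] and dv = directional_diameter_attained[OF v]
  have p: "0 < ?p" and q: "0 < ?q" using du dv by auto
  have p_le: "?p \<le> diameter K" using norm_D_le[OF du(1)] u p by simp
  have wv: "w \<bullet> v = h / ?q" using w q by (simp add: h_def)
  have wu: "w \<bullet> u \<le> h / ?p" using width_attained(2)[OF w(1) du(1)] p
    by (simp add: h_def field_simps)
  have abs: "\<bar>w \<bullet> v\<bar> \<le> 1" "\<bar>w \<bullet> u\<bar> \<le> 1" "\<bar>v \<bullet> u\<bar> \<le> 1"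
    using Cauchy_Schwarz_ineq2[of w v] Cauchy_Schwarz_ineq2[of w u] Cauchy_Schwarz_ineq2[of v u]
      w u v by auto
  have hq: "h \<le> ?q" using abs(1) q h by (simp add: wv)
  have hpq: "0 < h / ?p" "h / ?p \<le> h / ?q" "h / ?q \<le> 1"
    using h p q le hq by (auto intro: divide_left_mono)
  have "arccos (h / ?p) \<le> arccos (w \<bullet> u)"
    using wu abs hpq by (intro arccos_le_arccos) (auto simp: abs_le_iff)
  also have "\<dots> \<le> arccos (h / ?q) + arccos (u \<bullet> v)"
    using arccos_inner_triangle[OF w(1) v u] wv by (simp add: inner_commute)
  finally have ang: "arccos (h / ?p) - arccos (h / ?q) \<le> arccos (u \<bullet> v)" by simp
  \<comment> \<open>If \<open>p = h / cos \<phi>\<close> and \<open>q = h / cos \<psi>\<close>, then \<open>h p = p q cos \<psi>\<close> and \<open>h q = p q cos \<phi>\<close>, so that the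
    secant estimate for the cosine applies with radius \<open>p q\<close>.\<close>
  have "h * ?p - h * ?q \<le> (arccos (h * ?q / (?p * ?q)) - arccos (h * ?p / (?p * ?q))) *
      sqrt ((?p * ?q)\<^sup>2 - (h * ?q)\<^sup>2)"
    using h p q le hq by (intro diff_le_arccos_diff) (auto simp: mult.commute[of h])
  also have "(?p * ?q)\<^sup>2 - (h * ?q)\<^sup>2 = ?q\<^sup>2 * (?p\<^sup>2 - h\<^sup>2)"
    by (simp add: algebra_simps power2_eq_square)
  also have "sqrt \<dots> = ?q * sqrt (?p\<^sup>2 - h\<^sup>2)"
    using q by (simp add: real_sqrt_mult)
  also have "h * ?q / (?p * ?q) = h / ?p" using q by simp
  also have "h * ?p / (?p * ?q) = h / ?q" using p by simp
  finally have "?p - ?q \<le> (arccos (h / ?p) - arccos (h / ?q)) * (?q / h * sqrt (?p\<^sup>2 - h\<^sup>2))"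
    using h by (simp add: field_simps)
  also have "\<dots> \<le> arccos (u \<bullet> v) * (diameter K / thickness K * sqrt ((diameter K)\<^sup>2 - (thickness K)\<^sup>2))"
  proof (rule mult_mono[OF ang])
    \<comment> \<open>Both \<open>?q\<close> and \<open>?p\<close> are at most the diameter, and
      \<open>h\<close> is at least the thickness.\<close>
    show "?q / h * sqrt (?p\<^sup>2 - h\<^sup>2) \<le>
        diameter K / thickness K * sqrt ((diameter K)\<^sup>2 - (thickness K)\<^sup>2)"
      using h p q le hq p_le thickness_pos
      by (intro mult_mono frac_le real_sqrt_le_mono diff_mono power_mono) (auto intro: power_mono)
    show "0 \<le> arccos (u \<bullet> v)"
      using abs(3) by (intro arccos_lbound) (auto simp: abs_le_iff inner_commute)
    show "0 \<le> ?q / h * sqrt (?p\<^sup>2 - h\<^sup>2)"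
      using h q le hq by (auto intro!: mult_nonneg_nonneg power_mono)
  qed
  finally show ?thesis .
qed

text \<open>Width and directional diameter are even in the direction, so \<open>v\<close> may be
  replaced by whichever of \<open>v\<close>, \<open>- v\<close> has nonnegative inner product with
  \<open>u\<close>; then \<open>arccos\<close> of that product is
  \<open>line_angle u v\<close>.\<close>

lemma width_directional_diameter_lipschitz:
  assumes u: "norm u = 1" and v: "norm v = 1"
  shows "\<bar>width K u - width K v\<bar>
      \<le> line_angle u v * sqrt ((diameter K)\<^sup>2 - (thickness K)\<^sup>2)"
    and "\<bar>directional_diameter K u - directional_diameter K v\<bar>
      \<le> line_angle u v * (diameter K / thickness K * sqrt ((diameter K)\<^sup>2 - (thickness K)\<^sup>2))"
proof -
  obtain v' where v': "v' = v \<or> v' = - v" "u \<bullet> v' = \<bar>u \<bullet> v\<bar>"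
    by (cases "u \<bullet> v \<ge> 0") (auto intro: that[of v] that[of "- v"])
  have n: "norm v' = 1" using v v' by auto
  have sym: "v' \<bullet> u = u \<bullet> v'" by (rule inner_commute)
  have eq: "width K v = width K v'" "directional_diameter K v = directional_diameter K v'"
    using v'(1) width_minus[OF v] directional_diameter_minus[of v] by auto
  show "\<bar>width K u - width K v\<bar>
      \<le> line_angle u v * sqrt ((diameter K)\<^sup>2 - (thickness K)\<^sup>2)"
    using width_diff_le[OF u n] width_diff_le[OF n u]
    unfolding eq line_angle_def v'(2)[symmetric] sym by linarith
  show "\<bar>directional_diameter K u - directional_diameter K v\<bar>
      \<le> line_angle u v * (diameter K / thickness K * sqrt ((diameter K)\<^sup>2 - (thickness K)\<^sup>2))"
    using directional_diameter_diff_le[OF u n] directional_diameter_diff_le[OF n u]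
    unfolding eq line_angle_def v'(2)[symmetric] sym by linarith
qed

end

text \<open>Equality in Cauchy-Schwarz would make the unit vectors equal or opposite. Positivity
  permits division by the angle.\<close>

lemma line_angle_pos:
  assumes u: "norm u = 1" and v: "norm v = 1" and ne: "u \<noteq> v" "u \<noteq> - v"
  shows "0 < line_angle u v"
proof -
  have "\<bar>u \<bullet> v\<bar> \<noteq> 1"
    using norm_cauchy_schwarz_abs_eq[of u v] u v ne by auto
  then have "\<bar>u \<bullet> v\<bar> < 1"
    using Cauchy_Schwarz_ineq2[of u v] u v by simp
  then show ?thesis
    using arccos_less_arccos[of "\<bar>u \<bullet> v\<bar>" 1] by (simp add: line_angle_def)
qed

theorem theorem2:
  fixes K :: "(real ^ 'n) set"
  assumes "CARD('n) \<ge> 2" and "convex_body K"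
  shows "\<forall>u \<in> sphere 0 1. \<forall>v \<in> sphere 0 1. u \<noteq> v \<and> u \<noteq> - v \<longrightarrow>
    \<bar>width K u - width K v\<bar> / line_angle u v
      \<le> sqrt ((diameter K)\<^sup>2 - (thickness K)\<^sup>2) \<and>
    \<bar>directional_diameter K u - directional_diameter K v\<bar> / line_angle u v
      \<le> diameter K / thickness K * sqrt ((diameter K)\<^sup>2 - (thickness K)\<^sup>2)"
proof (intro ballI impI)
  interpret convex_body_locale K using assms(2) by unfold_locales
  fix u v :: "real ^ 'n"
  assume "u \<in> sphere 0 1" "v \<in> sphere 0 1" "u \<noteq> v \<and> u \<noteq> - v"
  then have *: "norm u = 1" "norm v = 1" "u \<noteq> v" "u \<noteq> - v" by auto
  show "\<bar>width K u - width K v\<bar> / line_angle u v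
      \<le> sqrt ((diameter K)\<^sup>2 - (thickness K)\<^sup>2) \<and>
    \<bar>directional_diameter K u - directional_diameter K v\<bar> / line_angle u v
      \<le> diameter K / thickness K * sqrt ((diameter K)\<^sup>2 - (thickness K)\<^sup>2)"
    using width_directional_diameter_lipschitz[OF *(1,2)]
    unfolding pos_divide_le_eq[OF line_angle_pos[OF *]] by (simp only: mult.commute simp_thms)
qed

end
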